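(* Consider friezes on polygons with values in $\mathbb{Z}[\sqrt2]$. (1) The set of friezes from dissections (into triangles and quadrilaterals) is strictly contained in the set of $\mathbb{Z}_{\ge 0}[\sqrt2]$ friezes. (2) The set of $\mathbb{Z}_{\ge 0}[\sqrt2]$ friezes is strictly contained in the set of $\mathbb{Z}[\sqrt2]_{\ge 1}$ friezes. (3) The set of unitary friezes is incomparable (under inclusion) with each of the following sets: the set of friezes from dissections, the set of $\mathbb{Z}_{\ge 0}[\sqrt2]$ friezes, and the set of $\mathbb{Z}[\sqrt2]_{\ge 1}$ friezes.
   Context: Polygons and friezes. An $n$-gon $P$ ($n\ge 3$) is convex with vertices $0,1,\dots,n-1$ in cyclic order (indices mod $n$). An arc is an unordered pair $(i,j)$ with $i\neq j$; arcs $(i,i+1)$ are boundary arcs, all others are diagonals. Two arcs $(i,j)$, $(k,\ell)$ cross if, cyclically, $i<k<j<\ell$ or $i<\ell<j<k$. A frieze on $P$ over an integral domain $R$ is a map $f:V\times V\to R$ ($V$ the vertex set) such that: $f(i,j)=0$ iff $i=j$; $f(i,i+1)=f(i,i-1)=1$; $f(i,j)=f(j,i)$; and if $(i,j)$, $(k,\ell)$ are crossing diagonals then $f(i,j)f(k,\ell)=f(i,\ell)f(j,k)+f(i,k)f(j,\ell)$ (Ptolemy relation). Here $R=\mathbb{Z}[\sqrt2]\subset\mathbb{R}$, and the sets in the claim include friezes on $n$-gons for all $n$. Friezes from dissections. A dissection $\mathcal{D}$ of $P$ is a (possibly empty) set of pairwise non-crossing diagonals of $P$; here all dissections divide $P$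 into triangles and quadrilaterals (the subpolygons). The frieze from the dissection $\mathcal{D}$, denoted $f_{\mathcal{D}}$, is the frieze on $P$ over $\mathbb{Z}[\sqrt2]$ with $f_{\mathcal{D}}=1$ on every edge of every subpolygon and $f_{\mathcal{D}}=\sqrt2$ on both diagonals of every quadrilateral subpolygon; the other values are determined by iterating the Ptolemy relation. Types of friezes. A frieze $f$ on an $n$-gon over $\mathbb{Z}[\sqrt2]$ is a $\mathbb{Z}[\sqrt2]_{\ge 1}$ frieze if $f(i,j)\ge 1$ for all $0\le i<j\le n-1$; it is a $\mathbb{Z}_{\ge 0}[\sqrt2]$ frieze if for all $0\le i<j\le n-1$, $f(i,j)=a+b\sqrt2$ with $a,b\in\mathbb{Z}_{\ge 0}$; it is unitary if there is a triangulation $\{\tau_1,\dots,\tau_m\}$ of the polygon (a maximal set of pairwise non-crossing diagonals) with $f(\tau_i)\in\mathbb{Z}[\sqrt2]^\times$ for all $i$. Two sets are incomparable if neither is contained in the other. *)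

theory Defs
  imports Complex_Main "HOL-Library.FuncSet"
begin

section \<open>Polygons, arcs and crossings\<close>

text \<open>The vertices of the \<open>n\<close>-gon are \<open>0, \<dots>, n - 1\<close>; an arc, being an unordered pair of
  distinct vertices, is a two-element set of vertices.\<close>

definition vertices :: "nat \<Rightarrow> nat set" where
  "vertices n = {0..<n}"

definition arcs :: "nat \<Rightarrow> nat set set" where
  "arcs n = {{i, j} | i j. i \<in> vertices n \<and> j \<in> vertices n \<and> i \<noteq> j}"

definition boundary_arcs :: "nat \<Rightarrow> nat set set" where
  "boundary_arcs n = {{i, (i + 1) mod n} | i. i \<in> vertices n}"

definition diagonals :: "nat \<Rightarrow> nat set set" where
  "diagonals n = arcs n - boundary_arcs n"

text \<open>Strict cyclic orders \<open>a < b < c\<close> and \<open>a < b < c < d\<close>: some rotation of the tuple is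
  strictly increasing.\<close>

definition cyclic3 :: "nat \<Rightarrow> nat \<Rightarrow> nat \<Rightarrow> bool" where
  "cyclic3 a b c \<longleftrightarrow> (a < b \<and> b < c) \<or> (b < c \<and> c < a) \<or> (c < a \<and> a < b)"

definition cyclic4 :: "nat \<Rightarrow> nat \<Rightarrow> nat \<Rightarrow> nat \<Rightarrow> bool" where
  "cyclic4 a b c d \<longleftrightarrow>
     (a < b \<and> b < c \<and> c < d) \<or> (b < c \<and> c < d \<and> d < a) \<or>
     (c < d \<and> d < a \<and> a < b) \<or> (d < a \<and> a < b \<and> b < c)"

text \<open>The arcs \<open>(i, j)\<close> and \<open>(k, l)\<close> cross.\<close>

definition crossing :: "nat \<Rightarrow> nat \<Rightarrow> nat \<Rightarrow> nat \<Rightarrow> bool" where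
  "crossing i j k l \<longleftrightarrow> cyclic4 i k j l \<or> cyclic4 i l j k"

section \<open>Friezes\<close>

text \<open>A frieze on the \<open>n\<close>-gon over a subring \<open>R\<close> of an integral domain. The extensional
  function space makes equality of friezes mean equality on pairs of vertices. The index
  \<open>i + n - 1\<close> is \<open>i - 1\<close> modulo \<open>n\<close>, avoiding truncated subtraction.\<close>

definition is_frieze :: "'a::idom set \<Rightarrow> nat \<Rightarrow> (nat \<times> nat \<Rightarrow> 'a) \<Rightarrow> bool" where
  "is_frieze R n f \<longleftrightarrow>
     n \<ge> 3 \<and>
     f \<in> (vertices n \<times> vertices n) \<rightarrow>\<^sub>E R \<and>
     (\<forall>i\<in>vertices n. \<forall>j\<in>vertices n. f (i, j) = 0 \<longleftrightarrow> i = j) \<and>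
     (\<forall>i\<in>vertices n. f (i, (i + 1) mod n) = 1 \<and> f (i, (i + n - 1) mod n) = 1) \<and>
     (\<forall>i\<in>vertices n. \<forall>j\<in>vertices n. f (i, j) = f (j, i)) \<and>
     (\<forall>i j k l. {i, j} \<in> diagonals n \<longrightarrow> {k, l} \<in> diagonals n \<longrightarrow> crossing i j k l \<longrightarrow>
        f (i, j) * f (k, l) = f (i, l) * f (j, k) + f (i, k) * f (j, l))"

definition zsqrt2 :: "real set" where
  "zsqrt2 = {of_int a + of_int b * sqrt 2 | a b :: int. True}"

definition zsqrt2_nonneg :: "real set" where
  "zsqrt2_nonneg = {of_int a + of_int b * sqrt 2 | a b :: int. a \<ge> 0 \<and> b \<ge> 0}"

definition zsqrt2_units :: "real set" where
  "zsqrt2_units = {x \<in> zsqrt2. \<exists>y\<in>zsqrt2. x * y = 1}"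

section \<open>Dissections and triangulations\<close>

definition is_dissection :: "nat \<Rightarrow> nat set set \<Rightarrow> bool" where
  "is_dissection n D \<longleftrightarrow>
     D \<subseteq> diagonals n \<and>
     (\<forall>i j k l. {i, j} \<in> D \<longrightarrow> {k, l} \<in> D \<longrightarrow> \<not> crossing i j k l)"

definition is_triangulation :: "nat \<Rightarrow> nat set set \<Rightarrow> bool" where
  "is_triangulation n T \<longleftrightarrow>
     is_dissection n T \<and> (\<forall>T'. is_dissection n T' \<and> T \<subseteq> T' \<longrightarrow> T' = T)"

text \<open>The polygon spanned by a set \<open>W\<close> of vertices: its edges join vertices that are
  consecutive in the cyclic order on \<open>W\<close>, its diagonals are the other pairs.\<close>

definition polygon_edges :: "nat set \<Rightarrow> nat set set" where
  "polygon_edges W =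
     {{a, b} | a b. a \<in> W \<and> b \<in> W \<and> a \<noteq> b \<and> (\<forall>c\<in>W. \<not> cyclic3 a c b)}"

definition polygon_diagonals :: "nat set \<Rightarrow> nat set set" where
  "polygon_diagonals W = {{a, b} | a b. a \<in> W \<and> b \<in> W \<and> a \<noteq> b} - polygon_edges W"

text \<open>The subpolygons cut out by a dissection \<open>D\<close> are given by their vertex sets. A polygon
  bounded by arcs of \<open>D\<close> and boundary arcs is a single piece exactly when no arc of \<open>D\<close> is
  one of its diagonals: an arc of \<open>D\<close> cannot cross its edges, as \<open>D\<close> is non-crossing.\<close>

definition is_subpolygon :: "nat \<Rightarrow> nat set set \<Rightarrow> nat set \<Rightarrow> bool" where
  "is_subpolygon n D W \<longleftrightarrow>
     W \<subseteq> vertices n \<and> card W \<ge> 3 \<and>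
     polygon_edges W \<subseteq> D \<union> boundary_arcs n \<and>
     polygon_diagonals W \<inter> D = {}"

definition is_34_dissection :: "nat \<Rightarrow> nat set set \<Rightarrow> bool" where
  "is_34_dissection n D \<longleftrightarrow>
     is_dissection n D \<and> (\<forall>W. is_subpolygon n D W \<longrightarrow> card W = 3 \<or> card W = 4)"

definition frieze_from_dissection :: "nat \<Rightarrow> nat set set \<Rightarrow> (nat \<times> nat \<Rightarrow> real) \<Rightarrow> bool" where
  "frieze_from_dissection n D f \<longleftrightarrow>
     is_frieze zsqrt2 n f \<and>
     (\<forall>W. is_subpolygon n D W \<longrightarrow>
        (\<forall>i j. {i, j} \<in> polygon_edges W \<longrightarrow> f (i, j) = 1) \<and>
        (card W = 4 \<longrightarrow> (\<forall>i j. {i, j} \<in> polygon_diagonals W \<longrightarrow> f (i, j) = sqrt 2)))"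

section \<open>Sets of friezes\<close>

text \<open>A frieze on some polygon is recorded together with the number \<open>n\<close> of vertices.\<close>

definition dissection_friezes :: "(nat \<times> (nat \<times> nat \<Rightarrow> real)) set" where
  "dissection_friezes =
     {(n, f). n \<ge> 3 \<and> (\<exists>D. is_34_dissection n D \<and> frieze_from_dissection n D f)}"

definition nonneg_friezes :: "(nat \<times> (nat \<times> nat \<Rightarrow> real)) set" where
  "nonneg_friezes =
     {(n, f). is_frieze zsqrt2 n f \<and> (\<forall>i j. i < j \<and> j < n \<longrightarrow> f (i, j) \<in> zsqrt2_nonneg)}"

definition ge1_friezes :: "(nat \<times> (nat \<times> nat \<Rightarrow> real)) set" where
  "ge1_friezes =
     {(n, f). is_frieze zsqrt2 n f \<and> (\<forall>i j. i < j \<and> j < n \<longrightarrow> f (i, j) \<ge> 1)}"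

definition unitary_friezes :: "(nat \<times> (nat \<times> nat \<Rightarrow> real)) set" where
  "unitary_friezes =
     {(n, f). is_frieze zsqrt2 n f \<and>
        (\<exists>T. is_triangulation n T \<and> (\<forall>i j. {i, j} \<in> T \<longrightarrow> f (i, j) \<in> zsqrt2_units))}"

definition incomparable :: "'a set \<Rightarrow> 'a set \<Rightarrow> bool" where
  "incomparable A B \<longleftrightarrow> \<not> A \<subseteq> B \<and> \<not> B \<subseteq> A"

text \<open>Consistency of the two notions of edge, on the full polygon.\<close>

lemma polygon_edges_vertices:
  assumes "n \<ge> 3"
  shows "polygon_edges (vertices n) = boundary_arcs n"
proof -
  have succ: "(a + 1) mod n = (if a + 1 < n then a + 1 else 0)" if "a < n" for a
  proof (cases "a + 1 < n")
    case False
    with that have "a + 1 = n" by linarith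
    then show ?thesis by simp
  qed simp
  have next_iff: "b < n \<and> a \<noteq> b \<and> (\<forall>c\<in>{0..<n}. \<not> cyclic3 a c b) \<longleftrightarrow> b = (a + 1) mod n"
    (is "?L \<longleftrightarrow> ?R") if a: "a < n" for a b
  proof
    assume L: ?L
    show ?R
    proof (cases "a + 1 < n")
      case True
      with L have "\<not> cyclic3 a (a + 1) b" by simp
      with L have "b = a + 1" unfolding cyclic3_def by linarith
      with True succ[OF a] show ?thesis by simp
    next
      case False
      from L have "\<not> cyclic3 a 0 b" by simp
      with L False have "b = 0" unfolding cyclic3_def by linarith
      with False succ[OF a] show ?thesis by simp
    qed
  next
    assume R: ?R
    have b: "b < n" "a \<noteq> b" using R succ[OF a] a assms by (simp_all split: if_splits)
    have "\<not> cyclic3 a c b" if "c < n" for c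
      using R succ[OF a] a that unfolding cyclic3_def by (simp split: if_splits)
    with b show ?L by simp
  qed
  have "(a \<in> {0..<n} \<and> b \<in> {0..<n} \<and> a \<noteq> b \<and> (\<forall>c\<in>{0..<n}. \<not> cyclic3 a c b)) \<longleftrightarrow>
      (a \<in> {0..<n} \<and> b = (a + 1) mod n)" for a b
    using next_iff[of a b] by (simp only: atLeastLessThan_iff) blast
  then have "polygon_edges (vertices n) = {{a, b} | a b. a \<in> {0..<n} \<and> b = (a + 1) mod n}"
    unfolding polygon_edges_def vertices_def by (simp only:)
  then show ?thesis
    unfolding boundary_arcs_def vertices_def by (simp only: simp_thms ex_simps) blast
qed

end

theory Submission
  imports Defs
begin

text \<open>The part that needs an argument is that the values of a frieze from a dissection have
  nonnegative coefficients. If an arc \<open>(a, b)\<close> of the dissection crosses \<open>(i, j)\<close>, then \<open>f (a, b) = 1\<close> and the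
  Ptolemy relation expresses \<open>f (i, j)\<close> as \<open>f (i, b) f (j, a) + f (i, a) f (j, b)\<close>, whose four arcs are
  crossed by fewer arcs of the dissection. If no arc of the dissection crosses \<open>(i, j)\<close>, then \<open>i\<close> and
  \<open>j\<close> lie in a common piece and the value is \<open>1\<close> or \<open>sqrt 2\<close>. So all values are built from \<open>1\<close> and
  \<open>sqrt 2\<close> by addition and multiplication (\<open>dissection_frieze_nonneg\<close>). The existence of the common
  piece is the combinatorial heart: a maximal set of vertices no two of which are separated by the
  dissection is a subpolygon (\<open>maximal_clique_is_subpolygon\<close>).

  The second inclusion only says that a nonzero \<open>a + b sqrt 2\<close> with nonnegative integers \<open>a\<close> and
  \<open>b\<close> is at least \<open>1\<close>.

  Everything else is shown by four examples. An octagon frieze with nonnegative coefficients and no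
  diagonal of value \<open>1\<close> cannot come from a dissection. A hexagon frieze with values at least \<open>1\<close>
  contains \<open>2 sqrt 2 - 1\<close>. The square with both diagonals \<open>sqrt 2\<close> comes from the empty dissection
  but is not unitary, and the square with diagonals \<open>1 + sqrt 2\<close> and \<open>2 sqrt 2 - 2\<close> is unitary but has
  a value below \<open>1\<close>. Since the three sets other than the unitary friezes form a chain, the two
  squares settle all three incomparability claims.\<close>

section \<open>Cyclic order and crossings\<close>

text \<open>Fixing the first argument turns the cyclic order into a linear order on the remaining
  vertices (\<open>cyclic3_trans\<close>), and \<open>b\<close> lies strictly between \<open>p\<close> and \<open>q\<close> in that order exactly
  when \<open>(a, b)\<close> and \<open>(p, q)\<close> cross. With four or more vertices this is much more convenient than
  comparing the numbers themselves.\<close>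

lemma cyclic4_cyclic3: "cyclic4 a b c d \<longleftrightarrow> cyclic3 a b c \<and> cyclic3 a c d"
  unfolding cyclic4_def cyclic3_def by auto

lemma cyclic4_rotate: "cyclic4 a b c d \<longleftrightarrow> cyclic4 b c d a"
  unfolding cyclic4_def by argo

lemma crossing_pair_commute: "crossing i j p q \<longleftrightarrow> crossing p q i j"
  unfolding crossing_def using cyclic4_rotate by metis

lemma crossing_swap:
  "crossing i j p q \<longleftrightarrow> crossing j i p q" "crossing i j p q \<longleftrightarrow> crossing i j q p"
  unfolding crossing_def using cyclic4_rotate by metis+

lemma cyclic3_trans: "cyclic3 a x y \<Longrightarrow> cyclic3 a y z \<Longrightarrow> cyclic3 a x z"
  unfolding cyclic3_def by auto

lemma crossing_distinct:
  assumes "crossing i j p q"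
  shows "distinct [i, j, p, q]"
  using assms unfolding crossing_def cyclic4_def by auto

text \<open>The arc \<open>(p, q)\<close> separates \<open>i\<close> from \<open>j\<close>, so any vertex off this arc is on the side of one
  of them and separated from the other.\<close>

lemma crossing_endpoint_cases:
  assumes "crossing i j p q" "a \<noteq> p" "a \<noteq> q"
  shows "crossing i a p q \<or> crossing a j p q"
  using assms unfolding crossing_def cyclic4_def by (elim disjE conjE) auto

lemma crossing_cyclic3:
  assumes "cyclic3 a c b" "cyclic3 b d a"
  shows "crossing c d a b"
proof -
  have "cyclic3 a b d" using assms(2) unfolding cyclic3_def by argo
  then have "crossing a b c d" using assms(1) by (simp add: crossing_def cyclic4_cyclic3)
  then show ?thesis using crossing_pair_commute by blast
qed

lemma cyclic3_crossing:
  assumes "cyclic3 a c b" "crossing c b a q"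
  shows "cyclic3 c q b"
  using assms unfolding crossing_def cyclic4_def cyclic3_def by auto

text \<open>The arc \<open>(p, q)\<close> lies on one side of \<open>(a, b)\<close>, possibly touching it, and separates \<open>a\<close> from
  \<open>i\<close>, so it lies on the side of \<open>i\<close>. As \<open>j\<close> is on the other side, it is separated from \<open>i\<close>
  too.\<close>

lemma crossing_across:
  assumes "crossing i a p q" "crossing i j a b" "\<not> crossing a b p q"
  shows "crossing i j p q"
proof (rule ccontr)
  assume neg: "\<not> crossing i j p q"
  have ai: "crossing a i p q" and ab: "crossing a b i j"
    using assms(1,2) crossing_swap(1) crossing_pair_commute by blast+
  have "j = p \<or> j = q \<or> crossing a j p q"
    using crossing_endpoint_cases[OF assms(1), of j] neg crossing_swap(1) by blast
  then have "crossing a b p q"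
    using ai ab cyclic3_trans unfolding crossing_def cyclic4_cyclic3 by meson
  then show False using assms(3) by blast
qed

lemma cyclic3_total:
  assumes "distinct [a, b, c]"
  shows "cyclic3 a c b \<or> cyclic3 b c a"
  using assms unfolding cyclic3_def by auto

lemma cyclic3_distinct: "cyclic3 a b c \<Longrightarrow> distinct [a, b, c]"
  unfolding cyclic3_def by auto

lemma cyclic3_asym: "cyclic3 a b c \<Longrightarrow> \<not> cyclic3 c b a"
  unfolding cyclic3_def by auto

lemma Suc_mod_if: "a < n \<Longrightarrow> (a + 1) mod n = (if a + 1 < n then a + 1 else (0::nat))"
  by (cases "a + 1 = n") auto

lemma crossing_successor:
  assumes "a < n" "p < n" "q < n"
  shows "\<not> crossing a ((a + 1) mod n) p q"
  unfolding Suc_mod_if[OF assms(1)] crossing_def cyclic4_def using assms by auto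

lemma cyclic3_successor:
  assumes "cyclic3 a x b" "a < n" "x < n" "b < n"
  shows "cyclic3 a ((a + 1) mod n) b"
  unfolding Suc_mod_if[OF assms(2)] using assms unfolding cyclic3_def by auto

lemma no_cyclic3_successor:
  assumes "\<And>x. x < n \<Longrightarrow> \<not> cyclic3 a x b" "a < n" "b < n" "a \<noteq> b"
  shows "b = (a + 1) mod n"
  using assms(1)[of "(a + 1) mod n"] assms(2-) unfolding Suc_mod_if[OF assms(2)] cyclic3_def
  by (auto split: if_splits)

lemma boundary_arcs_uncrossed:
  assumes "{a, b} \<in> boundary_arcs n" "p < n" "q < n"
  shows "\<not> crossing a b p q"
proof -
  obtain i where i: "i < n" "{a, b} = {i, (i + 1) mod n}"
    using assms(1) by (auto simp: boundary_arcs_def vertices_def)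
  then show ?thesis
    using crossing_successor[OF i(1) assms(2,3)] crossing_swap(1) by (auto simp: doubleton_eq_iff)
qed

lemma diagonals_vertices:
  assumes "{p, q} \<in> diagonals n"
  shows "p < n" "q < n" "p \<noteq> q"
  using assms by (auto simp: diagonals_def arcs_def vertices_def doubleton_eq_iff)

lemma crossing_diagonals:
  assumes "crossing i j p q" "i < n" "j < n" "p < n" "q < n"
  shows "{i, j} \<in> diagonals n"
  using assms boundary_arcs_uncrossed[of i j n p q] crossing_distinct[OF assms(1)]
  by (auto simp: diagonals_def arcs_def vertices_def)

section \<open>The pieces of a dissection\<close>

text \<open>A pair of vertices is uncrossed when its segment stays within one closed piece of the
  dissection.\<close>

definition uncrossed :: "nat set set \<Rightarrow> nat \<Rightarrow> nat \<Rightarrow> bool" where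
  "uncrossed D u v \<longleftrightarrow> (\<forall>p q. {p, q} \<in> D \<longrightarrow> \<not> crossing u v p q)"

lemma uncrossed_commute: "uncrossed D u v \<longleftrightarrow> uncrossed D v u"
  unfolding uncrossed_def using crossing_swap(1) by blast

lemma uncrossed_refl: "uncrossed D u u"
  unfolding uncrossed_def using crossing_distinct by fastforce

lemma uncrossed_dissection_or_boundary:
  assumes "is_dissection n D" "{a, b} \<in> D \<union> boundary_arcs n"
  shows "uncrossed D a b"
  using assms boundary_arcs_uncrossed diagonals_vertices(1,2)
  unfolding uncrossed_def is_dissection_def by blast

definition uncrossed_clique :: "nat \<Rightarrow> nat set set \<Rightarrow> nat set \<Rightarrow> bool" where
  "uncrossed_clique n D W \<longleftrightarrow> W \<subseteq> vertices n \<and> (\<forall>u\<in>W. \<forall>v\<in>W. uncrossed D u v)"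

text \<open>Take for \<open>c\<close> the vertex farthest from \<open>a\<close>, strictly between \<open>a\<close> and \<open>b\<close>, that is joined to
  \<open>a\<close> by an arc of \<open>D\<close> or a boundary arc; the successor of \<open>a\<close> is a candidate. An arc of \<open>D\<close>
  separating \<open>c\<close> from some \<open>w\<close> in \<open>W\<close> must end in \<open>a\<close>, since otherwise it would separate \<open>a\<close> from
  \<open>c\<close> or from \<open>w\<close>.
  In the same way its other end is \<open>b\<close> or lies between \<open>c\<close> and \<open>b\<close>. The latter contradicts the
  choice of \<open>c\<close>, and the former is what the last assumption excludes: an arc \<open>(a, b)\<close> of \<open>D\<close>
  would hide \<open>c\<close> from all of \<open>W\<close> except \<open>a\<close> and \<open>b\<close>.\<close>

lemma clique_extend:
  assumes D: "is_dissection n D" and W: "uncrossed_clique n D W" and ab: "a \<in> W" "b \<in> W"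
    and gap: "x < n" "cyclic3 a x b" "\<forall>c\<in>W. \<not> cyclic3 a c b"
    and side: "{a, b} \<notin> D \<or> W = {a, b}"
  obtains c where "c \<notin> W" "uncrossed_clique n D (insert c W)"
proof -
  have n: "a < n" "b < n" using W ab by (auto simp: uncrossed_clique_def vertices_def)
  \<comment> \<open>position of \<open>d\<close> when the vertices are counted cyclically starting after \<open>a\<close>\<close>
  define h where "h d = (if d > a then d else d + n)" for d
  define S where "S = {c. c < n \<and> cyclic3 a c b \<and> {a, c} \<in> D \<union> boundary_arcs n}"
  have "(a + 1) mod n \<in> S"
    using cyclic3_successor[OF gap(2) n(1) gap(1) n(2)] n
    by (auto simp: S_def boundary_arcs_def vertices_def)
  moreover have "finite S" unfolding S_def by simp
  ultimately have "Max (h ` S) \<in> h ` S" and Max: "\<And>d. d \<in> S \<Longrightarrow> h d \<le> Max (h ` S)"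
    by (auto intro!: Max_in)
  then obtain c where c: "c \<in> S" and cmax: "\<And>d. d \<in> S \<Longrightarrow> h d \<le> h c" by force
  have cn: "c < n" "cyclic3 a c b" and ac: "uncrossed D a c"
    using c uncrossed_dissection_or_boundary[OF D] by (auto simp: S_def)
  have beyond: False if "{a, q} \<in> D" "cyclic3 c q b" for q
  proof -
    have q: "q < n" using D that(1) diagonals_vertices(2) by (auto simp: is_dissection_def)
    then have "cyclic3 a q b \<and> h c < h q"
      using cn that(2) n unfolding cyclic3_def h_def by auto
    then show False using cmax[of q] q that(1) by (auto simp: S_def)
  qed
  have main: False if "{a, q} \<in> D" "crossing c w a q" "w \<in> W" for w q
  proof (cases "q = b")
    case True
    then have "w = a \<or> w = b" using side that by auto
    then show False using crossing_distinct[OF that(2)] True by auto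
  next
    case False
    have "b \<noteq> a" using cyclic3_distinct[OF cn(2)] by auto
    with False crossing_endpoint_cases[OF that(2), of b]
    have "crossing c b a q \<or> crossing b w a q" by auto
    moreover have "uncrossed D b w" using W ab that(3) by (auto simp: uncrossed_clique_def)
    ultimately have "crossing c b a q" using that(1) by (auto simp: uncrossed_def)
    then show False using beyond[OF that(1)] cyclic3_crossing[OF cn(2)] by blast
  qed
  have cw: "uncrossed D c w" if w: "w \<in> W" for w
    unfolding uncrossed_def
  proof (intro allI impI notI)
    fix p q assume pq: "{p, q} \<in> D" "crossing c w p q"
    have "uncrossed D a w" "uncrossed D c a"
      using W ab w ac uncrossed_commute by (auto simp: uncrossed_clique_def)
    then have "p = a \<or> q = a"
      using crossing_endpoint_cases[OF pq(2), of a] pq(1) by (auto simp: uncrossed_def)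
    then show False
    proof
      assume "p = a" then show False using main pq w by blast
    next
      assume "q = a" then show False
        using main[of p w] pq w crossing_swap(2) by (auto simp: insert_commute)
    qed
  qed
  have "c \<notin> W" using gap(3) cn by blast
  moreover have "uncrossed_clique n D (insert c W)"
    using W cw cn uncrossed_commute uncrossed_refl by (auto simp: uncrossed_clique_def vertices_def)
  ultimately show thesis by (rule that)
qed

text \<open>By \<open>clique_extend\<close>, a maximal clique can skip vertices between consecutive members \<open>a\<close> and
  \<open>b\<close> only if \<open>(a, b)\<close> is an arc of \<open>D\<close>, so its edges are arcs of \<open>D\<close> or boundary arcs. It is not just a pair, as
  then it could be extended on a side that contains a further vertex. Finally, an arc of \<open>D\<close> that is
  a diagonal of the clique would separate two of its members.\<close>

lemma maximal_clique_is_subpolygon: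
  assumes D: "is_dissection n D" and n: "n \<ge> 3" and W: "uncrossed_clique n D W" and two: "card W \<ge> 2"
    and maximal: "\<And>c. uncrossed_clique n D (insert c W) \<Longrightarrow> c \<in> W"
  shows "is_subpolygon n D W"
proof -
  have Wn: "W \<subseteq> {..<n}" using W by (auto simp: uncrossed_clique_def vertices_def)
  have edge: "{a, b} \<in> D"
    if "a \<in> W" "b \<in> W" "x < n" "cyclic3 a x b" "\<forall>c\<in>W. \<not> cyclic3 a c b" for a b x
    using clique_extend[OF D W that] maximal by blast
  have not2: "W \<noteq> {a, b}" if "x < n" "cyclic3 a x b" for a b x
    using clique_extend[OF D W _ _ that(1,2)] maximal
    by (metis cyclic3_distinct distinct_length_2_or_more insertE insert_iff singletonD)
  have "card W \<noteq> 2"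
  proof
    assume "card W = 2"
    then obtain u v where uv: "W = {u, v}" "u \<noteq> v" by (auto simp: card_2_iff)
    have "\<not> {..<n} \<subseteq> {u, v}" using n card_mono[of "{u, v}" "{..<n}"] uv by auto
    then obtain x where "x < n" "x \<noteq> u" "x \<noteq> v" by auto
    then show False using cyclic3_total[of u v x] not2[of x u v] not2[of x v u] uv by auto
  qed
  then have "card W \<ge> 3" using two by linarith
  moreover have "polygon_edges W \<subseteq> D \<union> boundary_arcs n"
  proof
    fix e assume "e \<in> polygon_edges W"
    then obtain a b where e: "e = {a, b}" "a \<in> W" "b \<in> W" "a \<noteq> b" "\<forall>c\<in>W. \<not> cyclic3 a c b"
      by (auto simp: polygon_edges_def)
    show "e \<in> D \<union> boundary_arcs n"
    proof (cases "\<exists>x<n. cyclic3 a x b")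
      case True
      then show ?thesis using edge e by blast
    next
      case False
      then have "b = (a + 1) mod n" using no_cyclic3_successor[of n a b] e Wn by auto
      then show ?thesis using e Wn by (auto simp: boundary_arcs_def vertices_def)
    qed
  qed
  moreover have "polygon_diagonals W \<inter> D = {}"
  proof (rule ccontr)
    assume "polygon_diagonals W \<inter> D \<noteq> {}"
    then obtain a b where ab: "a \<in> W" "b \<in> W" "a \<noteq> b" "{a, b} \<notin> polygon_edges W" "{a, b} \<in> D"
      by (auto simp: polygon_diagonals_def)
    then obtain c d where "c \<in> W" "cyclic3 a c b" "d \<in> W" "cyclic3 b d a"
      unfolding polygon_edges_def mem_Collect_eq by (metis insert_commute)
    then have "crossing c d a b" "uncrossed D c d"
      using crossing_cyclic3 W by (auto simp: uncrossed_clique_def)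
    then show False using ab(5) by (auto simp: uncrossed_def)
  qed
  ultimately show ?thesis using Wn by (auto simp: is_subpolygon_def vertices_def)
qed

text \<open>This is how subpolygons are produced: the two vertices form a clique, and a maximal clique
  containing them is a piece.\<close>

lemma uncrossed_in_subpolygon:
  assumes D: "is_dissection n D" and n: "n \<ge> 3" and ij: "i < n" "j < n" "i \<noteq> j" "uncrossed D i j"
  obtains W where "is_subpolygon n D W" "i \<in> W" "j \<in> W"
proof -
  have "{W. uncrossed_clique n D W} \<subseteq> Pow (vertices n)" by (auto simp: uncrossed_clique_def)
  then have "finite {W. uncrossed_clique n D W}" by (rule finite_subset) (simp add: vertices_def)
  moreover have "uncrossed_clique n D {i, j}"
    using ij uncrossed_commute uncrossed_refl by (auto simp: uncrossed_clique_def vertices_def)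
  ultimately obtain W where W: "uncrossed_clique n D W" "{i, j} \<subseteq> W" "\<And>V. uncrossed_clique n D V \<Longrightarrow> W \<subseteq> V \<Longrightarrow> W = V"
    using finite_has_maximal2[of "{W. uncrossed_clique n D W}" "{i, j}"] by auto
  have "finite W" using W(1) finite_subset by (auto simp: uncrossed_clique_def vertices_def)
  then have "card W \<ge> 2" using card_mono[of W "{i, j}"] W(2) ij(3) by auto
  then have "is_subpolygon n D W"
    using maximal_clique_is_subpolygon[OF D n W(1)] W(3) by blast
  then show thesis using that W(2) by blast
qed

text \<open>A diagonal of \<open>W\<close> has a vertex of \<open>W\<close> strictly on either side.\<close>

lemma polygon_diagonals_card:
  assumes "polygon_diagonals W \<noteq> {}" "finite W"
  shows "card W \<ge> 4"
proof -
  obtain a b where ab: "a \<in> W" "b \<in> W" "a \<noteq> b" "{a, b} \<notin> polygon_edges W"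
    using assms(1) by (auto simp: polygon_diagonals_def)
  then obtain c d where cd: "c \<in> W" "cyclic3 a c b" "d \<in> W" "cyclic3 b d a"
    unfolding polygon_edges_def mem_Collect_eq by (metis insert_commute)
  then have "distinct [a, b, c, d]"
    using cyclic3_distinct[OF cd(2)] cyclic3_distinct[OF cd(4)] cyclic3_asym[OF cd(2)] by auto
  then have "card {a, b, c, d} = 4" by simp
  then show ?thesis using card_mono[of W "{a, b, c, d}"] ab cd assms(2) by simp
qed

section \<open>Arithmetic of \<open>\<int>[sqrt 2]\<close>\<close>

lemma sqrt2_bounds: "7 / 5 < sqrt 2" "sqrt 2 < 3 / 2"
  by (rule real_less_rsqrt real_less_lsqrt; simp add: power2_eq_square)+

lemma zsqrt2I: "of_int a + of_int b * sqrt 2 \<in> zsqrt2"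
  unfolding zsqrt2_def by blast

lemma zsqrt2_nonneg_subset: "zsqrt2_nonneg \<subseteq> zsqrt2"
  unfolding zsqrt2_nonneg_def zsqrt2_def by blast

text \<open>An inverse \<open>a + b sqrt 2\<close> would give \<open>1 - 2 b = a sqrt 2\<close>; after squaring, the left side is odd and
  the right side even.\<close>

lemma sqrt2_not_unit: "sqrt 2 \<notin> zsqrt2_units"
proof
  assume "sqrt 2 \<in> zsqrt2_units"
  then obtain a b where "sqrt 2 * (of_int a + of_int b * sqrt 2) = 1"
    unfolding zsqrt2_units_def zsqrt2_def by auto
  then have "1 - 2 * of_int b = of_int a * sqrt 2" by (simp add: algebra_simps)
  then have "(1 - 2 * of_int b)\<^sup>2 = (of_int a * sqrt 2)\<^sup>2" by simp
  then have "of_int ((1 - 2 * b)\<^sup>2) = (of_int (2 * a\<^sup>2) :: real)" by (simp add: power_mult_distrib)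
  then have "(1 - 2 * b)\<^sup>2 = 2 * a\<^sup>2" by (simp only: of_int_eq_iff)
  then have "even ((1 - 2 * b)\<^sup>2)" by simp
  then show False by simp
qed

lemma zsqrt2_nonnegI: "a \<ge> 0 \<Longrightarrow> b \<ge> 0 \<Longrightarrow> of_int a + of_int b * sqrt 2 \<in> zsqrt2_nonneg"
  unfolding zsqrt2_nonneg_def by blast

lemma zsqrt2_nonneg_add:
  assumes "x \<in> zsqrt2_nonneg" "y \<in> zsqrt2_nonneg"
  shows "x + y \<in> zsqrt2_nonneg"
proof -
  obtain a b c d where "x = of_int a + of_int b * sqrt 2" "y = of_int c + of_int d * sqrt 2"
    and "a \<ge> 0" "b \<ge> 0" "c \<ge> 0" "d \<ge> 0" using assms unfolding zsqrt2_nonneg_def by blast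
  then show ?thesis using zsqrt2_nonnegI[of "a + c" "b + d"] by (simp add: algebra_simps)
qed

lemma zsqrt2_nonneg_mult:
  assumes "x \<in> zsqrt2_nonneg" "y \<in> zsqrt2_nonneg"
  shows "x * y \<in> zsqrt2_nonneg"
proof -
  obtain a b c d where "x = of_int a + of_int b * sqrt 2" "y = of_int c + of_int d * sqrt 2"
    and "a \<ge> 0" "b \<ge> 0" "c \<ge> 0" "d \<ge> 0" using assms unfolding zsqrt2_nonneg_def by blast
  then show ?thesis using zsqrt2_nonnegI[of "a * c + 2 * (b * d)" "a * d + b * c"]
    by (simp add: algebra_simps)
qed

lemma zsqrt2_nonneg_one: "1 \<in> zsqrt2_nonneg" and zsqrt2_nonneg_sqrt2: "sqrt 2 \<in> zsqrt2_nonneg"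
  using zsqrt2_nonnegI[of 1 0] zsqrt2_nonnegI[of 0 1] by auto

lemma zsqrt2_nonneg_values:
  "{1, 2, sqrt 2, 1 + sqrt 2, 2 + sqrt 2} \<subseteq> zsqrt2_nonneg"
  using zsqrt2_nonneg_one zsqrt2_nonneg_sqrt2 zsqrt2_nonneg_add[of 1 1]
    zsqrt2_nonneg_add[of 1 "sqrt 2"] zsqrt2_nonneg_add[of 2 "sqrt 2"] by simp

lemma zsqrt2_values:
  "{0, 1, 2, sqrt 2, 1 + sqrt 2, 2 + sqrt 2, 2 * sqrt 2 - 1, 2 * sqrt 2 - 2, 4 - 2 * sqrt 2, sqrt 2 - 1}
    \<subseteq> zsqrt2"
  using zsqrt2_nonneg_values zsqrt2_nonneg_subset zsqrt2I[of 0 0] zsqrt2I[of "-1" 2]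
    zsqrt2I[of "-2" 2] zsqrt2I[of 4 "-2"] zsqrt2I[of "-1" 1] by auto

lemma two_sqrt2_minus_1_not_nonneg: "2 * sqrt 2 - 1 \<notin> zsqrt2_nonneg"
proof
  assume "2 * sqrt 2 - 1 \<in> zsqrt2_nonneg"
  then obtain a b where eq: "2 * sqrt 2 - 1 = of_int a + of_int b * sqrt 2" and ab: "a \<ge> 0" "b \<ge> 0"
    unfolding zsqrt2_nonneg_def by blast
  have "b < 2"
  proof (rule ccontr)
    assume "\<not> b < 2"
    then have "2 * sqrt 2 \<le> of_int b * sqrt 2" by (intro mult_right_mono) auto
    then show False using eq ab by linarith
  qed
  then consider "b = 0" | "b = 1" using ab by linarith
  then show False
  proof cases
    case 1
    then have "1 < real_of_int a" "real_of_int a < 2" using eq sqrt2_bounds by auto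
    then have "1 < a" "a < 2" by linarith+
    then show False by simp
  next
    case 2
    then have "0 < real_of_int a" "real_of_int a < 1" using eq sqrt2_bounds by auto
    then have "0 < a" "a < 1" by linarith+
    then show False by simp
  qed
qed

lemma zsqrt2_nonneg_ge1:
  assumes "x \<in> zsqrt2_nonneg" "x \<noteq> 0"
  shows "1 \<le> x"
proof -
  obtain a b where x: "x = of_int a + of_int b * sqrt 2" and ab: "a \<ge> 0" "b \<ge> 0"
    using assms(1) unfolding zsqrt2_nonneg_def by blast
  have nonneg: "0 \<le> of_int b * sqrt 2" "(0 :: real) \<le> of_int a" using ab by simp_all
  have "a \<noteq> 0 \<or> b \<noteq> 0" using x assms(2) by auto
  then consider "1 \<le> a" | "1 \<le> b" using ab by linarith
  then show ?thesis
  proof cases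
    case 1
    then show ?thesis using x nonneg by linarith
  next
    case 2
    then have "1 * 1 \<le> of_int b * sqrt 2" by (intro mult_mono) auto
    then show ?thesis using x nonneg by linarith
  qed
qed

section \<open>Values of a frieze from a dissection\<close>

lemma is_frieze_zero_iff:
  assumes "is_frieze R n f" "i < n" "j < n"
  shows "f (i, j) = 0 \<longleftrightarrow> i = j"
  using assms unfolding is_frieze_def vertices_def by simp

lemma is_frieze_commute:
  assumes "is_frieze R n f" "i < n" "j < n"
  shows "f (i, j) = f (j, i)"
  using assms unfolding is_frieze_def vertices_def by simp

lemma is_frieze_ptolemy:
  assumes "is_frieze R n f" "crossing i j k l" "i < n" "j < n" "k < n" "l < n"
  shows "f (i, j) * f (k, l) = f (i, l) * f (j, k) + f (i, k) * f (j, l)"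
proof -
  have "{i, j} \<in> diagonals n" "{k, l} \<in> diagonals n"
    using crossing_diagonals assms(2-) crossing_pair_commute by metis+
  then show ?thesis using assms(1,2) unfolding is_frieze_def by simp
qed

lemma is_frieze_boundary:
  assumes f: "is_frieze R n f" and "{a, b} \<in> boundary_arcs n"
  shows "f (a, b) = 1"
proof -
  obtain i where i: "i < n" "{a, b} = {i, (i + 1) mod n}"
    using assms(2) by (auto simp: boundary_arcs_def vertices_def)
  have one: "f (i, (i + 1) mod n) = 1" and "n \<ge> 3"
    using f i unfolding is_frieze_def vertices_def by auto
  then show ?thesis
    using is_frieze_commute[OF f i(1), of "(i + 1) mod n"] i by (auto simp: doubleton_eq_iff)
qed

text \<open>An arc of \<open>D\<close> is never a diagonal of a piece, so in a piece containing both of its ends it is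
  an edge.\<close>

lemma dissection_frieze_arc:
  assumes "n \<ge> 3" "is_dissection n D" "frieze_from_dissection n D f" "{a, b} \<in> D"
  shows "f (a, b) = 1"
proof -
  have ab: "a < n" "b < n" "a \<noteq> b"
    using assms(2,4) diagonals_vertices[of a b n] by (auto simp: is_dissection_def)
  obtain W where W: "is_subpolygon n D W" "a \<in> W" "b \<in> W"
    using uncrossed_in_subpolygon[OF assms(2,1) ab] uncrossed_dissection_or_boundary assms by blast
  then have "{a, b} \<notin> polygon_diagonals W"
    using assms(4) by (auto simp: is_subpolygon_def)
  then have "{a, b} \<in> polygon_edges W"
    using W(2,3) ab(3) unfolding polygon_diagonals_def by blast
  then show ?thesis using assms(3) W(1) by (auto simp: frieze_from_dissection_def)
qed

lemma dissection_frieze_uncrossed: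
  assumes "n \<ge> 3" and D: "is_34_dissection n D" and f: "frieze_from_dissection n D f"
    and ij: "i < n" "j < n" "i \<noteq> j" "uncrossed D i j"
  shows "f (i, j) = 1 \<or> f (i, j) = sqrt 2"
proof -
  obtain W where W: "is_subpolygon n D W" "i \<in> W" "j \<in> W"
    using uncrossed_in_subpolygon[OF _ assms(1) ij] D by (auto simp: is_34_dissection_def)
  show ?thesis
  proof (cases "{i, j} \<in> polygon_edges W")
    case True
    then show ?thesis using f W(1) by (auto simp: frieze_from_dissection_def)
  next
    case False
    then have diag: "{i, j} \<in> polygon_diagonals W"
      using W(2,3) ij(3) by (auto simp: polygon_diagonals_def)
    have "finite W" using W(1) finite_subset by (auto simp: is_subpolygon_def vertices_def)
    then have "card W = 4"
      using polygon_diagonals_card[of W] diag D W(1) by (fastforce simp: is_34_dissection_def)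
    then show ?thesis using f W(1) diag by (auto simp: frieze_from_dissection_def)
  qed
qed

definition crossing_arcs :: "nat set set \<Rightarrow> nat \<Rightarrow> nat \<Rightarrow> nat set set" where
  "crossing_arcs D i j = {e \<in> D. \<exists>p q. e = {p, q} \<and> crossing i j p q}"

lemma crossing_arcs_commute: "crossing_arcs D i j = crossing_arcs D j i"
  unfolding crossing_arcs_def using crossing_swap(1) by blast

lemma crossing_arcs_psubset:
  assumes D: "is_dissection n D" and ab: "{a, b} \<in> D" "crossing i j a b"
  shows "crossing_arcs D i a \<subset> crossing_arcs D i j"
proof -
  have "crossing i j p q" if "crossing i a p q" "{p, q} \<in> D" for p q
    using crossing_across[OF that(1) ab(2)] D ab(1) that(2) by (auto simp: is_dissection_def)
  then have "crossing_arcs D i a \<subseteq> crossing_arcs D i j"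
    unfolding crossing_arcs_def by blast
  moreover have "{a, b} \<in> crossing_arcs D i j" using ab by (auto simp: crossing_arcs_def)
  moreover have "{a, b} \<notin> crossing_arcs D i a"
    using crossing_distinct by (fastforce simp: crossing_arcs_def doubleton_eq_iff)
  ultimately show ?thesis by blast
qed

text \<open>If \<open>D\<close> does not cross \<open>(i, j)\<close>, the value is read off from a piece. Otherwise the Ptolemy
  relation with a crossing arc \<open>(a, b)\<close> of \<open>D\<close>, where the frieze is \<open>1\<close>, writes \<open>f (i, j)\<close> as a sum
  of products of values on arcs that fewer arcs of \<open>D\<close> cross.\<close>

lemma dissection_frieze_nonneg:
  assumes n: "n \<ge> 3" and D: "is_34_dissection n D" and f: "frieze_from_dissection n D f"
    and "i < n" "j < n" "i \<noteq> j"
  shows "f (i, j) \<in> zsqrt2_nonneg"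
  using assms(4-)
proof (induction "card (crossing_arcs D i j)" arbitrary: i j rule: less_induct)
  case less
  have D': "is_dissection n D" using D by (simp add: is_34_dissection_def)
  have fr: "is_frieze zsqrt2 n f" using f by (simp add: frieze_from_dissection_def)
  show ?case
  proof (cases "uncrossed D i j")
    case True
    then show ?thesis
      using dissection_frieze_uncrossed[OF n D f less.prems] zsqrt2_nonneg_one zsqrt2_nonneg_sqrt2
      by auto
  next
    case False
    then obtain a b where ab: "{a, b} \<in> D" "crossing i j a b" by (auto simp: uncrossed_def)
    have abn: "a < n" "b < n" using ab(1) D' diagonals_vertices by (auto simp: is_dissection_def)
    have "D \<subseteq> Pow {..<n}" using D'
      by (auto simp: is_dissection_def diagonals_def arcs_def vertices_def)
    then have fin: "finite D" by (rule finite_subset) simp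
    have IH: "f (u, c) \<in> zsqrt2_nonneg"
      if "u = i \<and> v = j \<or> u = j \<and> v = i" "c = a \<and> d = b \<or> c = b \<and> d = a" for u v c d
    proof -
      have cd: "{c, d} \<in> D" "crossing u v c d"
        using that ab crossing_swap by (auto simp: insert_commute)
      have "crossing_arcs D u v = crossing_arcs D i j" using that(1) crossing_arcs_commute by auto
      then have "crossing_arcs D u c \<subset> crossing_arcs D i j"
        using crossing_arcs_psubset[OF D' cd] by simp
      moreover have "finite (crossing_arcs D i j)" using fin by (simp add: crossing_arcs_def)
      ultimately have "card (crossing_arcs D u c) < card (crossing_arcs D i j)"
        by (rule psubset_card_mono[rotated])
      then show ?thesis
        using less.hyps[of u c] that less.prems abn crossing_distinct[OF ab(2)] by auto
    qed
    have "f (i, j) * f (a, b) = f (i, b) * f (j, a) + f (i, a) * f (j, b)"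
      using is_frieze_ptolemy[OF fr ab(2)] less.prems abn by simp
    then have "f (i, j) = f (i, b) * f (j, a) + f (i, a) * f (j, b)"
      using dissection_frieze_arc[OF n D' f ab(1)] by simp
    then show ?thesis
      using IH[of i j a b] IH[of i j b a] IH[of j i a b] IH[of j i b a]
      by (simp add: zsqrt2_nonneg_add zsqrt2_nonneg_mult)
  qed
qed

section \<open>Friezes from vectors in the plane\<close>

text \<open>A frieze is determined by its first two rows through \<open>f (i, j) = det (v\<^sub>i, v\<^sub>j)\<close> for \<open>i < j\<close>,
  where \<open>v\<^sub>0 = (1, 0)\<close> and \<open>v\<^sub>j = (- f (1, j), f (0, j))\<close> for \<open>j > 0\<close>. The examples below are given
  in this form.\<close>

definition wedge :: "(nat \<Rightarrow> 'a::comm_ring) \<Rightarrow> (nat \<Rightarrow> 'a) \<Rightarrow> nat \<Rightarrow> nat \<Rightarrow> 'a" where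
  "wedge x y i j = x i * y j - x j * y i"

definition wedge_frieze :: "nat \<Rightarrow> (nat \<Rightarrow> 'a::comm_ring) \<Rightarrow> (nat \<Rightarrow> 'a) \<Rightarrow> nat \<times> nat \<Rightarrow> 'a" where
  "wedge_frieze n x y =
     restrict (\<lambda>(i, j). wedge x y (min i j) (max i j)) (vertices n \<times> vertices n)"

lemma wedge_frieze_le: "i \<le> j \<Longrightarrow> j < n \<Longrightarrow> wedge_frieze n x y (i, j) = wedge x y i j"
  by (simp add: wedge_frieze_def vertices_def min_def max_def)

lemma wedge_frieze_ge: "j \<le> i \<Longrightarrow> i < n \<Longrightarrow> wedge_frieze n x y (i, j) = wedge x y j i"
  by (simp add: wedge_frieze_def vertices_def min_def max_def)

text \<open>The Ptolemy relation holds as the Pluecker relation between \<open>2 \<times> 2\<close> minors, so checking that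
  an explicit list of vectors defines a frieze only needs the individual values. They are given as a
  set \<open>A\<close> of possible diagonal values, which suits a case-by-case evaluation.\<close>

lemma is_frieze_wedge_frieze:
  fixes x y :: "nat \<Rightarrow> 'a::idom"
  assumes n: "n \<ge> 3" and R: "0 \<in> R" "1 \<in> R" "A \<subseteq> R - {0}"
    and wedge: "\<forall>j<n. \<forall>i<j. wedge x y i j \<in> (if j = i + 1 \<or> i = 0 \<and> j = n - 1 then {1} else A)"
  shows "is_frieze R n (wedge_frieze n x y)"
proof -
  let ?f = "wedge_frieze n x y"
  have R': "wedge x y i j \<in> R - {0}" if "i < j" "j < n" for i j
  proof -
    have "wedge x y i j \<in> (if j = i + 1 \<or> i = 0 \<and> j = n - 1 then {1} else A)"
      using wedge that by blast
    then show ?thesis using R by (auto split: if_splits)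
  qed
  have step: "wedge x y i (Suc i) = 1" if "i < n - 1" for i
  proof -
    have "Suc i < n" using that by linarith
    then show ?thesis using wedge[rule_format, of "Suc i" i] by simp
  qed
  have closing: "wedge x y 0 (n - 1) = 1"
    using wedge[rule_format, of "n - 1" 0] n by simp
  have diag: "wedge x y i i = 0" for i by (simp add: wedge_def)
  have vals: "?f (i, j) \<in> R \<and> (?f (i, j) = 0 \<longleftrightarrow> i = j) \<and> ?f (i, j) = ?f (j, i)"
    if "i < n" "j < n" for i j
    using that R(1) R'[of i j] R'[of j i] diag
    by (cases i j rule: linorder_cases) (auto simp: wedge_frieze_le wedge_frieze_ge)
  have ext: "?f \<in> vertices n \<times> vertices n \<rightarrow>\<^sub>E R"
    using vals by (auto simp: PiE_iff extensional_def vertices_def wedge_frieze_def)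
  have succ: "?f (i, (i + 1) mod n) = 1" if "i < n" for i
  proof (cases "i + 1 < n")
    case True
    then show ?thesis using step[of i] by (simp add: wedge_frieze_le)
  next
    case False
    then have "i = n - 1" using that by linarith
    then show ?thesis using closing n by (simp add: wedge_frieze_ge)
  qed
  have pred: "?f (i, (i + n - 1) mod n) = 1" if "i < n" for i
  proof (cases i)
    case 0
    then show ?thesis using closing n by (simp add: wedge_frieze_le)
  next
    case (Suc k)
    then show ?thesis using step[of k] that by (simp add: wedge_frieze_ge)
  qed
  have ptolemy: "?f (i, j) * ?f (k, l) = ?f (i, l) * ?f (j, k) + ?f (i, k) * ?f (j, l)"
    if "crossing i j k l" "i < n" "j < n" "k < n" "l < n" for i j k l
    using that unfolding crossing_def cyclic4_def
    by (elim disjE conjE) (simp_all add: wedge_frieze_le wedge_frieze_ge wedge_def algebra_simps)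
  show ?thesis
    unfolding is_frieze_def
    using n ext vals succ pred ptolemy diagonals_vertices by (simp add: vertices_def)
qed

section \<open>Friezes on the square\<close>

lemma vertices_4: "vertices 4 = {0, 1, 2, 3}"
  unfolding vertices_def by auto

lemma boundary_arcs_4: "boundary_arcs 4 = {{0, 1}, {1, 2}, {2, 3}, {3, 0}}"
proof -
  have "boundary_arcs 4 = (\<lambda>i. {i, (i + 1) mod 4}) ` vertices 4"
    unfolding boundary_arcs_def by blast
  then show ?thesis unfolding vertices_4 by (simp flip: numeral_2_eq_2)
qed

lemma diagonals_4: "diagonals 4 = {{0, 2}, {1, 3}}"
proof
  show "diagonals 4 \<subseteq> {{0, 2}, {1, 3}}"
  proof
    fix e assume e: "e \<in> diagonals 4"
    then obtain i j where ij: "e = {i, j}" "i < 4" "j < 4" "i \<noteq> j"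
      by (auto simp: diagonals_def arcs_def vertices_def)
    obtain k l where kl: "e = {k, l}" "k < l" "l < 4"
      using that[of i j] that[of j i] ij by (cases i j rule: linorder_cases) (auto simp: insert_commute)
    then consider "k = 0" "l = 1" | "k = 1" "l = 2" | "k = 2" "l = 3" | "k = 0" "l = 3" |
      "k = 0" "l = 2" | "k = 1" "l = 3" by linarith
    then show "e \<in> {{0, 2}, {1, 3}}"
      using e kl(1) unfolding diagonals_def boundary_arcs_4 by cases (simp_all add: insert_commute)
  qed
  have "{0, 2} \<in> arcs 4" "{1, 3} \<in> arcs 4"
    unfolding arcs_def vertices_def by (rule CollectI, rule exI, rule exI, rule conjI, rule refl, simp)+
  then show "{{0, 2}, {1, 3}} \<subseteq> diagonals 4"
    unfolding diagonals_def boundary_arcs_4 by (simp add: doubleton_eq_iff)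
qed

lemma square_triangulation:
  assumes "e \<in> diagonals 4"
  shows "is_triangulation 4 {e}"
proof -
  have "is_dissection 4 {e}"
    using assms crossing_distinct by (fastforce simp: is_dissection_def doubleton_eq_iff)
  moreover have "T = {e}" if T: "is_dissection 4 T" "{e} \<subseteq> T" for T
  proof -
    have "crossing 0 2 1 3" by (simp add: crossing_def cyclic4_def)
    then have "\<not> ({0, 2} \<in> T \<and> {1, 3} \<in> T)" using T(1) unfolding is_dissection_def by blast
    moreover have "T \<subseteq> {{0, 2}, {1, 3}}"
      using T(1) diagonals_4 by (auto simp: is_dissection_def)
    ultimately show ?thesis using T(2) assms diagonals_4 by blast
  qed
  ultimately show ?thesis unfolding is_triangulation_def by blast
qed

lemma square_triangulation_nonempty:
  assumes "is_triangulation 4 T"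
  shows "T \<noteq> {}"
proof
  assume "T = {}"
  moreover have "is_dissection 4 {{0, 2}}"
    using square_triangulation[of "{0, 2}"] diagonals_4 by (simp add: is_triangulation_def)
  ultimately show False using assms unfolding is_triangulation_def by blast
qed

text \<open>The frieze with values \<open>a\<close> and \<open>b\<close> on the two diagonals; the Ptolemy relation forces
  \<open>a b = 2\<close>.\<close>

definition square_frieze :: "real \<Rightarrow> real \<Rightarrow> nat \<times> nat \<Rightarrow> real" where
  "square_frieze a b = wedge_frieze 4 (nth [1, 0, -1, -b]) (nth [0, 1, a, 1])"

lemma is_frieze_square_frieze:
  assumes "a * b = 2" "a \<in> zsqrt2" "b \<in> zsqrt2"
  shows "is_frieze zsqrt2 4 (square_frieze a b)"
    and "square_frieze a b (0, 2) = a" "square_frieze a b (1, 3) = b"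
proof -
  have "a \<noteq> 0" "b \<noteq> 0" using assms by auto
  moreover have "\<forall>j<4. \<forall>i<j. wedge (nth [1, 0, -1, -b]) (nth [0, 1, a, 1]) i j \<in>
      (if j = i + 1 \<or> i = 0 \<and> j = 4 - 1 then {1} else {a, b})"
    using assms by (simp add: wedge_def numeral_eq_Suc All_less_Suc algebra_simps)
  ultimately show "is_frieze zsqrt2 4 (square_frieze a b)"
    unfolding square_frieze_def using zsqrt2_values assms
    by (intro is_frieze_wedge_frieze[where A = "{a, b}"]) auto
  show "square_frieze a b (0, 2) = a" "square_frieze a b (1, 3) = b"
    by (simp_all add: square_frieze_def wedge_frieze_le wedge_def)
qed

lemma square_frieze_sqrt2_from_dissection:
  "(4, square_frieze (sqrt 2) (sqrt 2)) \<in> dissection_friezes"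
proof -
  let ?f = "square_frieze (sqrt 2) (sqrt 2)"
  have f: "is_frieze zsqrt2 4 ?f" and diag: "?f (0, 2) = sqrt 2" "?f (1, 3) = sqrt 2"
    using is_frieze_square_frieze[of "sqrt 2" "sqrt 2"] zsqrt2_values by auto
  have card: "card W \<le> 4" if "W \<subseteq> vertices 4" for W
    using card_mono[of "vertices 4" W] that by (simp add: vertices_def)
  have "is_34_dissection 4 {}"
    unfolding is_34_dissection_def
  proof (intro conjI allI impI)
    show "is_dissection 4 {}" by (simp add: is_dissection_def)
    fix W assume "is_subpolygon 4 {} W"
    then have "3 \<le> card W" "card W \<le> 4" using card by (simp_all add: is_subpolygon_def)
    then show "card W = 3 \<or> card W = 4" by linarith
  qed
  moreover have "frieze_from_dissection 4 {} ?f"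
    unfolding frieze_from_dissection_def
  proof (intro conjI allI impI f)
    fix W i j assume W: "is_subpolygon 4 {} W"
    show "?f (i, j) = 1" if "{i, j} \<in> polygon_edges W"
      using that W is_frieze_boundary[OF f] by (auto simp: is_subpolygon_def)
    assume "card W = 4" and ij: "{i, j} \<in> polygon_diagonals W"
    moreover have "W \<subseteq> vertices 4" using W by (simp add: is_subpolygon_def)
    ultimately have "W = vertices 4" by (intro card_subset_eq) (simp_all add: vertices_def)
    then have "{i, j} \<in> diagonals 4"
      using ij polygon_edges_vertices[of 4]
      by (auto simp: polygon_diagonals_def diagonals_def arcs_def)
    then have "{i, j} = {0, 2} \<or> {i, j} = {1, 3}" by (simp add: diagonals_4)
    then show "?f (i, j) = sqrt 2"
      using diag is_frieze_commute[OF f, of 2 0] is_frieze_commute[OF f, of 3 1]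
      by (auto simp: doubleton_eq_iff)
  qed
  ultimately show ?thesis by (auto simp: dissection_friezes_def)
qed

text \<open>Every triangulation of the square contains a diagonal, and \<open>sqrt 2\<close> is not a unit.\<close>

lemma square_frieze_sqrt2_not_unitary:
  "(4, square_frieze (sqrt 2) (sqrt 2)) \<notin> unitary_friezes"
proof
  let ?f = "square_frieze (sqrt 2) (sqrt 2)"
  assume "(4, ?f) \<in> unitary_friezes"
  then obtain T where T: "is_triangulation 4 T" "\<forall>i j. {i, j} \<in> T \<longrightarrow> ?f (i, j) \<in> zsqrt2_units"
    by (auto simp: unitary_friezes_def)
  have "T \<subseteq> {{0, 2}, {1, 3}}"
    using T(1) diagonals_4 by (simp add: is_triangulation_def is_dissection_def)
  then have "{0, 2} \<in> T \<or> {1, 3} \<in> T" using square_triangulation_nonempty[OF T(1)] by blast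
  then have "?f (0, 2) \<in> zsqrt2_units \<or> ?f (1, 3) \<in> zsqrt2_units" using T(2) by blast
  moreover have "?f (0, 2) = sqrt 2" "?f (1, 3) = sqrt 2"
    using is_frieze_square_frieze[of "sqrt 2" "sqrt 2"] zsqrt2_values by auto
  ultimately show False using sqrt2_not_unit by simp
qed

text \<open>The diagonal value \<open>1 + sqrt 2\<close> is a unit greater than \<open>1\<close>, and so large that the other
  diagonal value \<open>2 (sqrt 2 - 1)\<close> falls below \<open>1\<close>.\<close>

lemma square_frieze_fundamental_unit:
  shows "(4, square_frieze (1 + sqrt 2) (2 * sqrt 2 - 2)) \<in> unitary_friezes"
    and "(4, square_frieze (1 + sqrt 2) (2 * sqrt 2 - 2)) \<notin> ge1_friezes"
proof -
  let ?f = "square_frieze (1 + sqrt 2) (2 * sqrt 2 - 2)"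
  have "(1 + sqrt 2) * (2 * sqrt 2 - 2) = 2" by (simp add: algebra_simps)
  then have f: "is_frieze zsqrt2 4 ?f"
    and diag: "?f (0, 2) = 1 + sqrt 2" "?f (1, 3) = 2 * sqrt 2 - 2"
    using is_frieze_square_frieze[of "1 + sqrt 2" "2 * sqrt 2 - 2"] zsqrt2_values by auto
  have "(1 + sqrt 2) * (sqrt 2 - 1) = 1" by (simp add: algebra_simps)
  then have "1 + sqrt 2 \<in> zsqrt2_units" using zsqrt2_values by (auto simp: zsqrt2_units_def)
  then have "?f (i, j) \<in> zsqrt2_units" if "{i, j} \<in> {{0, 2}}" for i j
    using that diag(1) is_frieze_commute[OF f, of 2 0] by (auto simp: doubleton_eq_iff)
  moreover have "is_triangulation 4 {{0, 2}}"
    using square_triangulation[of "{0, 2}"] diagonals_4 by simp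
  ultimately show "(4, ?f) \<in> unitary_friezes"
    using f unfolding unitary_friezes_def by blast
  show "(4, ?f) \<notin> ge1_friezes"
  proof
    assume "(4, ?f) \<in> ge1_friezes"
    then have "1 \<le> ?f (1, 3)" by (simp add: ge1_friezes_def)
    then show False using diag(2) sqrt2_bounds by simp
  qed
qed

section \<open>Two friezes separating the remaining sets\<close>

text \<open>Two of the long diagonals have the value \<open>2 sqrt 2 - 1\<close>, which exceeds \<open>1\<close> in spite of its
  negative coefficient.\<close>

definition hexagon_frieze :: "nat \<times> nat \<Rightarrow> real" where
  "hexagon_frieze = wedge_frieze 6
     (nth [1, 0, -1, -2, 1 - 2 * sqrt 2, - 1 - sqrt 2])
     (nth [0, 1, sqrt 2, 2 * sqrt 2 - 1, 4 - 2 * sqrt 2, 1])"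

lemma hexagon_frieze_values:
  "\<forall>j<6. \<forall>i<j. wedge
     (nth [1, 0, -1, -2, 1 - 2 * sqrt 2, - 1 - sqrt 2])
     (nth [0, 1, sqrt 2, 2 * sqrt 2 - 1, 4 - 2 * sqrt 2, 1]) i j \<in>
    (if j = i + 1 \<or> i = 0 \<and> j = 6 - 1 then {1}
     else {2, sqrt 2, 1 + sqrt 2, 2 * sqrt 2 - 1, 4 - 2 * sqrt 2})"
  by (simp add: wedge_def numeral_eq_Suc All_less_Suc algebra_simps)

lemma hexagon_frieze_ge1: "(6, hexagon_frieze) \<in> ge1_friezes"
proof -
  let ?A = "{2, sqrt 2, 1 + sqrt 2, 2 * sqrt 2 - 1, 4 - 2 * sqrt 2}"
  have A: "1 \<le> a" if "a \<in> ?A" for a using that sqrt2_bounds by auto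
  have "?A \<subseteq> zsqrt2 - {0}" using A zsqrt2_values by force
  then have "is_frieze zsqrt2 6 hexagon_frieze"
    unfolding hexagon_frieze_def using zsqrt2_values
    by (intro is_frieze_wedge_frieze[OF _ _ _ _ hexagon_frieze_values]) auto
  moreover have "1 \<le> hexagon_frieze (i, j)" if "i < j" "j < 6" for i j
    using hexagon_frieze_values[rule_format, OF that(2,1)] A that
    unfolding hexagon_frieze_def by (simp add: wedge_frieze_le split: if_splits)
  ultimately show ?thesis by (simp add: ge1_friezes_def)
qed

lemma hexagon_frieze_not_nonneg: "(6, hexagon_frieze) \<notin> nonneg_friezes"
proof
  assume "(6, hexagon_frieze) \<in> nonneg_friezes"
  then have "hexagon_frieze (0, 3) \<in> zsqrt2_nonneg" by (simp add: nonneg_friezes_def)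
  moreover have "hexagon_frieze (0, 3) = 2 * sqrt 2 - 1"
    by (simp add: hexagon_frieze_def wedge_frieze_le wedge_def)
  ultimately show False using two_sqrt2_minus_1_not_nonneg by simp
qed

text \<open>The short diagonals of this octagon frieze alternate between \<open>a = sqrt 2\<close> and \<open>b = 1 + sqrt 2\<close>.
  A frieze with such a period two closes up after eight steps if the matrix product
  \<open>(a, -1; 1, 0) (b, -1; 1, 0)\<close> has fourth power \<open>- 1\<close>, which is the case as its trace \<open>a b - 2\<close> is
  \<open>sqrt 2\<close>.\<close>

definition octagon_frieze :: "nat \<times> nat \<Rightarrow> real" where
  "octagon_frieze = wedge_frieze 8
     (nth [1, 0, -1, - 1 - sqrt 2, - 1 - sqrt 2, - 2 - sqrt 2, - 1 - sqrt 2, - 1 - sqrt 2])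
     (nth [0, 1, sqrt 2, 1 + sqrt 2, 2, 1 + sqrt 2, sqrt 2, 1])"

lemma octagon_frieze_values:
  "\<forall>j<8. \<forall>i<j. wedge
     (nth [1, 0, -1, - 1 - sqrt 2, - 1 - sqrt 2, - 2 - sqrt 2, - 1 - sqrt 2, - 1 - sqrt 2])
     (nth [0, 1, sqrt 2, 1 + sqrt 2, 2, 1 + sqrt 2, sqrt 2, 1]) i j \<in>
    (if j = i + 1 \<or> i = 0 \<and> j = 8 - 1 then {1} else {sqrt 2, 1 + sqrt 2, 2, 2 + sqrt 2})"
  by (simp add: wedge_def numeral_eq_Suc All_less_Suc algebra_simps)

lemma octagon_frieze_nonneg: "(8, octagon_frieze) \<in> nonneg_friezes"
proof -
  let ?A = "{sqrt 2, 1 + sqrt 2, 2, 2 + sqrt 2}"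
  have "?A \<subseteq> zsqrt2 - {0}" using sqrt2_bounds zsqrt2_values by auto
  then have "is_frieze zsqrt2 8 octagon_frieze"
    unfolding octagon_frieze_def using zsqrt2_values
    by (intro is_frieze_wedge_frieze[OF _ _ _ _ octagon_frieze_values]) auto
  moreover have "octagon_frieze (i, j) \<in> zsqrt2_nonneg" if "i < j" "j < 8" for i j
    using octagon_frieze_values[rule_format, OF that(2,1)] zsqrt2_nonneg_values that
    unfolding octagon_frieze_def by (auto simp: wedge_frieze_le split: if_splits)
  ultimately show ?thesis by (simp add: nonneg_friezes_def)
qed

text \<open>A frieze from a nonempty dissection has the value \<open>1\<close> on some diagonal.\<close>

lemma octagon_frieze_not_from_dissection: "(8, octagon_frieze) \<notin> dissection_friezes"
proof
  assume "(8, octagon_frieze) \<in> dissection_friezes"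
  then obtain D where D: "is_34_dissection 8 D" and f: "frieze_from_dissection 8 D octagon_frieze"
    by (auto simp: dissection_friezes_def)
  have dis: "is_dissection 8 D" using D by (simp add: is_34_dissection_def)
  show False
  proof (cases "D = {}")
    case True
    \<comment> \<open>the whole octagon is the only piece, and it is too large\<close>
    have "is_subpolygon 8 D (vertices 8)"
      using polygon_edges_vertices[of 8] True by (simp add: is_subpolygon_def vertices_def)
    then have "card (vertices 8) = 3 \<or> card (vertices 8) = 4"
      using D by (simp add: is_34_dissection_def)
    then show False by (simp add: vertices_def)
  next
    case False
    then obtain e where e: "e \<in> D" "e \<in> diagonals 8" using dis by (auto simp: is_dissection_def)
    then obtain p q where pq: "e = {p, q}" "p < 8" "q < 8" "p \<noteq> q"
      by (auto simp: diagonals_def arcs_def vertices_def)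
    then obtain i j where ij: "e = {i, j}" "i < j" "j < 8"
      by (cases p q rule: linorder_cases) (auto simp: insert_commute)
    have "j \<noteq> i + 1"
    proof
      assume "j = i + 1"
      then have "e = {i, (i + 1) mod 8}" "i \<in> vertices 8" using ij by (simp_all add: vertices_def)
      then show False using e(2) by (auto simp: diagonals_def boundary_arcs_def)
    qed
    moreover have "\<not> (i = 0 \<and> j = 7)"
    proof
      assume "i = 0 \<and> j = 7"
      then have "e = {7, (7 + 1) mod 8}" "7 \<in> vertices 8"
        using ij(1) by (auto simp: vertices_def)
      then show False using e(2) unfolding diagonals_def boundary_arcs_def by blast
    qed
    ultimately have "octagon_frieze (i, j) \<in> {sqrt 2, 1 + sqrt 2, 2, 2 + sqrt 2}"
      using octagon_frieze_values[rule_format, OF ij(3,2)] ij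
      unfolding octagon_frieze_def by (auto simp: wedge_frieze_le split: if_splits)
    moreover have "octagon_frieze (i, j) = 1"
      using dissection_frieze_arc[OF _ dis f] e(1) ij(1) by simp
    ultimately show False using sqrt2_bounds by auto
  qed
qed

section \<open>Comparison of the four sets of friezes\<close>

lemma dissection_friezes_subset_nonneg_friezes: "dissection_friezes \<subseteq> nonneg_friezes"
proof (clarsimp simp: dissection_friezes_def nonneg_friezes_def)
  fix n D f
  assume n: "3 \<le> n" and D: "is_34_dissection n D" and f: "frieze_from_dissection n D f"
  have "f (i, j) \<in> zsqrt2_nonneg" if "i < j" "j < n" for i j
    using dissection_frieze_nonneg[OF n D f] that by simp
  then show "is_frieze zsqrt2 n f \<and> (\<forall>i j. i < j \<and> j < n \<longrightarrow> f (i, j) \<in> zsqrt2_nonneg)"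
    using f by (simp add: frieze_from_dissection_def)
qed

lemma nonneg_friezes_subset_ge1_friezes: "nonneg_friezes \<subseteq> ge1_friezes"
proof (clarsimp simp: nonneg_friezes_def ge1_friezes_def)
  fix n f i j
  assume f: "is_frieze zsqrt2 n f" and nonneg: "\<forall>i j. i < j \<and> j < n \<longrightarrow> f (i, j) \<in> zsqrt2_nonneg"
    and ij: "i < j" "j < n"
  then have "f (i, j) \<noteq> 0" using is_frieze_zero_iff[OF f, of i j] by simp
  then show "1 \<le> f (i, j)" using nonneg ij zsqrt2_nonneg_ge1 by blast
qed

theorem proposition1:
  shows "dissection_friezes \<subset> nonneg_friezes \<and>
         nonneg_friezes \<subset> ge1_friezes \<and>
         incomparable unitary_friezes dissection_friezes \<and>
         incomparable unitary_friezes nonneg_friezes \<and>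
         incomparable unitary_friezes ge1_friezes"
proof -
  note inclusions = dissection_friezes_subset_nonneg_friezes nonneg_friezes_subset_ge1_friezes
  have "dissection_friezes \<subset> nonneg_friezes"
    using inclusions octagon_frieze_nonneg octagon_frieze_not_from_dissection by blast
  moreover have "nonneg_friezes \<subset> ge1_friezes"
    using inclusions hexagon_frieze_ge1 hexagon_frieze_not_nonneg by blast
  moreover have "incomparable unitary_friezes F" if "dissection_friezes \<subseteq> F" "F \<subseteq> ge1_friezes" for F
    using that square_frieze_sqrt2_from_dissection square_frieze_sqrt2_not_unitary
      square_frieze_fundamental_unit unfolding incomparable_def by blast
  ultimately show ?thesis using inclusions by blast
qed

end
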